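(* Let $R$ be an integral domain. The following three conditions are equivalent: \begin{enumerate} \item $R$ is a Dedekind domain. \item $R$ is a Noetherian Containment-Division Ring. \item $R$ is a Containment-Division Ring fulfilling the Divisor Chain Condition. \end{enumerate}
   Context: All rings are commutative with unity. Divisibility of ideals: for ideals $I, J$ of a ring $R$, we say that $J$ divides $I$ if there exists an ideal $H$ of $R$ such that $I = HJ$ (product of ideals). Containment-Division Ring (CDR): a commutative ring with unity $R$ is a Containment-Division Ring if for any two ideals $I$ and $J$ of $R$, $I \subseteq J$ if and only if $J$ divides $I$. Divisor Chain Condition (DiCC): a commutative ring with unity $R$ fulfills the Divisor Chain Condition if every chain of ideals $I_1 \subseteq I_2 \subseteq \cdots \subseteq I_n \subseteq \cdots$ of $R$ such that $I_{j+1}$ divides $I_j$ for all $j \geq 1$ is stationary, i.e., there exists $m$ such that $I_i = I_m$ for all $i \geq m$. Dedekind domain: an integral domain in which every proper ideal (i.e., every ideal different from the whole ring) can be written as a finite product of prime ideals. (The zero ideal of an integral domain is prime; with this convention fields are Dedekind domains.) *)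

theory Defs
  imports "HOL-Algebra.Ideal_Product" "HOL-Algebra.Ring_Divisibility"
begin

definition ideal_divides :: "('a, 'b) ring_scheme \<Rightarrow> 'a set \<Rightarrow> 'a set \<Rightarrow> bool"
  where "ideal_divides R J I \<longleftrightarrow> (\<exists>H. ideal H R \<and> I = H \<cdot>\<^bsub>R\<^esub> J)"

locale containment_division_ring = cring +
  assumes subset_iff_divides:
    "\<lbrakk> ideal I R; ideal J R \<rbrakk> \<Longrightarrow> I \<subseteq> J \<longleftrightarrow> ideal_divides R J I"

text \<open>The chain is indexed from 0 instead of from 1.\<close>

locale divisor_chain_condition_ring = cring +
  assumes divisor_chain_stationary:
    "\<lbrakk> \<And>n. ideal (I n) R; \<And>n. I n \<subseteq> I (Suc n);
       \<And>n. ideal_divides R (I (Suc n)) (I n) \<rbrakk>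
     \<Longrightarrow> \<exists>m::nat. \<forall>i\<ge>m. I i = I m"

definition ideal_prod_list :: "('a, 'b) ring_scheme \<Rightarrow> 'a set list \<Rightarrow> 'a set"
  where "ideal_prod_list R Ps = foldr (\<lambda>I J. I \<cdot>\<^bsub>R\<^esub> J) Ps (carrier R)"

text \<open>
  The zero ideal of a domain is prime, so fields are Dedekind domains. The empty product
  is the whole ring, so a list of primes whose product is a proper ideal is nonempty.
\<close>

locale dedekind_domain = domain +
  assumes proper_ideal_prime_product:
    "\<lbrakk> ideal I R; I \<noteq> carrier R \<rbrakk>
     \<Longrightarrow> \<exists>Ps. (\<forall>P \<in> set Ps. primeideal P R) \<and> I = ideal_prod_list R Ps"

end

theory Submission
  imports Defs
begin

text \<open>
  The pivot of the proof is invertibility. In a domain, an ideal that divides a nonzero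
  principal ideal is an invertible ideal in the usual sense, expressed without the field of
  fractions. Such an ideal can be cancelled from products
  (\<open>divides_principal_imp_cancels\<close>), divides every ideal that it contains
  (\<open>divides_principal_imp_contains_is_divides\<close>), and is finitely generated
  (\<open>divides_principal_imp_finitely_generated\<close>). Hence a domain is a containment-division
  ring exactly when all its nonzero ideals are invertible, and it is then Noetherian. The ascending
  chain condition implies the divisor chain condition, so the second and the third
  condition follow from each other.

  From a Noetherian containment-division domain to a Dedekind domain: an ideal \<open>I\<close> maximal among
  the proper ideals without a prime factorization is nonzero and not prime, so it lies in a larger
  proper ideal \<open>J\<close>, and \<open>I = H J\<close>. By cancellation \<open>H\<close> is larger than \<open>I\<close> as well, so \<open>H\<close> and \<open>J\<close>
  have factorizations, which combine to one of \<open>I\<close>.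

  The deep direction is that all nonzero ideals of a Dedekind domain are invertible; for this it
  suffices to treat primes. A nonzero prime \<open>P\<close> contains some \<open>(a) \<noteq> 0\<close>, hence one of the prime
  factors of \<open>(a)\<close>, and these are invertible. So everything rests on the fact that an invertible
  prime is maximal (\<open>cancellable_prime_sum_principal\<close>). For a prime \<open>P\<close> and \<open>a \<notin> P\<close>, the
  ideals \<open>(P + (a))\<^sup>2\<close> and \<open>P + (a\<^sup>2)\<close> agree modulo \<open>P\<close>, and prime factorizations of cancellable
  ideals modulo \<open>P\<close> are unique (\<open>prime_factorization_unique_mod\<close>); as the primes involved all
  contain \<open>P\<close>, the two ideals are equal. In particular \<open>P \<subseteq> (P + (a))\<^sup>2\<close>, which forces
  \<open>P = P (P + (a))\<close>, and cancelling \<open>P\<close> gives \<open>P + (a) = R\<close>.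

  The classical argument applies uniqueness of factorization in the quotient \<open>R/P\<close>. Here
  ideals of \<open>R/P\<close> are replaced by ideals of \<open>R\<close> that contain \<open>P\<close>, and products are compared after
  adding \<open>P\<close>; the case \<open>P = 0\<close> of the same notion gives cancellation in \<open>R\<close> itself.
\<close>

text \<open>Equations between sums of ideals could otherwise be read as equations between disjoint sums.\<close>

no_notation Sum_Type.Plus (infixr \<open><+>\<close> 65)

section \<open>Sums and products of ideals\<close>

context ring
begin

lemma ideal_subset_carrier: "ideal I R \<Longrightarrow> I \<subseteq> carrier R"
  by (simp add: additive_subgroup.a_subset ideal.axioms(1))

lemma set_add_subset_iff:
  assumes "ideal A R" "ideal B R" "ideal C R"
  shows "A <+> B \<subseteq> C \<longleftrightarrow> A \<subseteq> C \<and> B \<subseteq> C"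
  using assms union_genideal[of A B] Idl_subset_ideal[of C "A \<union> B"]
  by (simp add: ideal_subset_carrier)

lemma subset_set_add:
  assumes "ideal A R" "ideal B R"
  shows "A \<subseteq> A <+> B" "B \<subseteq> A <+> B"
  using set_add_subset_iff[OF assms add_ideals[OF assms]] by auto

lemma zero_set_add:
  assumes "ideal A R"
  shows "{\<zero>} <+> A = A"
  using set_add_subset_iff[OF zeroideal assms assms] subset_set_add[OF zeroideal assms] assms
  by (auto simp: additive_subgroup.zero_closed ideal.axioms(1))

lemma ideal_prod_mono:
  assumes "A \<subseteq> A'" "B \<subseteq> B'"
  shows "A \<cdot> B \<subseteq> A' \<cdot> B'"
proof
  fix x assume "x \<in> A \<cdot> B"
  then show "x \<in> A' \<cdot> B'"
    by (induct rule: ideal_prod.induct) (use assms in \<open>auto intro: ideal_prod.intros\<close>)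
qed

end

context cring
begin

lemma ideal_prod_left_commute:
  assumes "ideal A R" "ideal B R" "ideal C R"
  shows "A \<cdot> (B \<cdot> C) = B \<cdot> (A \<cdot> C)"
  by (metis assms ideal_prod_assoc ideal_prod_commute)

lemma one_ideal_prod:
  assumes "ideal A R"
  shows "carrier R \<cdot> A = A"
  by (metis assms ideal_prod_commute ideal_prod_one oneideal)

lemma principal_ideal_prod:
  assumes a: "a \<in> carrier R" and A: "ideal A R"
  shows "(PIdl a) \<cdot> A = (\<lambda>x. a \<otimes> x) ` A"
proof
  interpret A: ideal A R by fact
  show "(PIdl a) \<cdot> A \<subseteq> (\<lambda>x. a \<otimes> x) ` A"
  proof
    fix y assume "y \<in> (PIdl a) \<cdot> A"
    then show "y \<in> (\<lambda>x. a \<otimes> x) ` A"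
    proof (induct rule: ideal_prod.induct)
      case (prod i j)
      then obtain r where r: "r \<in> carrier R" "i = r \<otimes> a"
        by (auto simp: cgenideal_def)
      then have "i \<otimes> j = a \<otimes> (r \<otimes> j)"
        using a prod by (simp add: m_ac A.Icarr)
      then show ?case
        using A.I_l_closed[of j r] prod r by blast
    next
      case (sum s t)
      then obtain x y where "x \<in> A" "y \<in> A" "s = a \<otimes> x" "t = a \<otimes> y" by blast
      then have "s \<oplus> t = a \<otimes> (x \<oplus> y)" "x \<oplus> y \<in> A"
        using a by (simp_all add: r_distr A.Icarr)
      then show ?case by blast
    qed
  qed
  show "(\<lambda>x. a \<otimes> x) ` A \<subseteq> (PIdl a) \<cdot> A"
    using cgenideal_self[OF a] by (auto intro: ideal_prod.prod)
qed

lemma principal_ideal_prod_principal: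
  assumes "a \<in> carrier R" "b \<in> carrier R"
  shows "(PIdl a) \<cdot> (PIdl b) = PIdl (a \<otimes> b)"
proof -
  have "(PIdl a) \<cdot> (PIdl b) = (\<lambda>x. a \<otimes> x) ` (PIdl b)"
    using assms by (simp add: principal_ideal_prod cgenideal_ideal)
  also have "\<dots> = PIdl (a \<otimes> b)"
    using assms by (force simp: cgenideal_def m_ac)
  finally show ?thesis .
qed

text \<open>The cofactor is the colon ideal \<open>(X : a)\<close>.\<close>

lemma subset_principal_imp_divides:
  assumes a: "a \<in> carrier R" and X: "ideal X R" and sub: "X \<subseteq> PIdl a"
  shows "\<exists>B. ideal B R \<and> X = (PIdl a) \<cdot> B"
proof -
  interpret X: ideal X R by fact
  define B where "B = {b \<in> carrier R. a \<otimes> b \<in> X}"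
  have B: "ideal B R"
  proof (rule idealI)
    show "subgroup B (add_monoid R)"
      using a by (intro add.subgroupI) (auto simp: B_def r_distr r_minus intro!: exI[of _ \<zero>])
    show "x \<otimes> b \<in> B" if "b \<in> B" "x \<in> carrier R" for b x
      using that a X.I_l_closed[of "a \<otimes> b" x] by (auto simp: B_def m_ac)
    then show "b \<otimes> x \<in> B" if "b \<in> B" "x \<in> carrier R" for b x
      using that by (metis (no_types, lifting) B_def m_comm mem_Collect_eq)
  qed (rule ring_axioms)
  have "X = (\<lambda>x. a \<otimes> x) ` B"
  proof
    show "X \<subseteq> (\<lambda>x. a \<otimes> x) ` B"
    proof
      fix x assume "x \<in> X"
      moreover obtain r where r: "r \<in> carrier R" "x = r \<otimes> a"
        using sub \<open>x \<in> X\<close> by (auto simp: cgenideal_def)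
      ultimately show "x \<in> (\<lambda>x. a \<otimes> x) ` B"
        using a by (intro image_eqI[of _ _ r]) (auto simp: B_def m_comm)
    qed
  qed (auto simp: B_def)
  then show ?thesis
    using B by (auto simp: principal_ideal_prod[OF a B])
qed

subsection \<open>Products of lists of ideals\<close>

lemma ideal_prod_list_Nil [simp]: "ideal_prod_list R [] = carrier R"
  and ideal_prod_list_Cons [simp]:
    "ideal_prod_list R (P # Ps) = P \<cdot> ideal_prod_list R Ps"
  by (simp_all add: ideal_prod_list_def)

lemma ideal_prod_list_ideal:
  "\<forall>P \<in> set Ps. ideal P R \<Longrightarrow> ideal (ideal_prod_list R Ps) R"
  by (induction Ps) (auto simp: oneideal ideal_prod_is_ideal)

lemma ideal_prod_list_append:
  assumes "\<forall>P \<in> set Ps. ideal P R" "\<forall>P \<in> set Qs. ideal P R"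
  shows "ideal_prod_list R (Ps @ Qs) = ideal_prod_list R Ps \<cdot> ideal_prod_list R Qs"
  using assms
  by (induction Ps) (auto simp: one_ideal_prod ideal_prod_assoc ideal_prod_list_ideal)

lemma ideal_prod_list_remove1:
  assumes "\<forall>P \<in> set Ps. ideal P R" "P \<in> set Ps"
  shows "ideal_prod_list R Ps = P \<cdot> ideal_prod_list R (remove1 P Ps)"
  using assms
proof (induction Ps)
  case (Cons Q Ps)
  have "ideal (ideal_prod_list R (remove1 P Ps)) R"
    using Cons.prems by (intro ideal_prod_list_ideal) (auto dest: notin_set_remove1)
  then show ?case
    using Cons by (cases "P = Q") (auto simp: ideal_prod_left_commute[of Q P])
qed auto

lemma member_divides_ideal_prod_list:
  assumes "\<forall>P \<in> set Ps. ideal P R" "P \<in> set Ps"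
  shows "ideal_divides R P (ideal_prod_list R Ps)"
proof -
  have "ideal (ideal_prod_list R (remove1 P Ps)) R"
    using assms by (intro ideal_prod_list_ideal) (auto dest: notin_set_remove1)
  then show ?thesis
    using ideal_prod_list_remove1[OF assms] assms ideal_prod_commute
    unfolding ideal_divides_def by metis
qed

lemma ideal_divides_imp_subset:
  assumes "ideal I R" "ideal_divides R J I" "ideal J R"
  shows "I \<subseteq> J"
  using assms ideal_prod_inter unfolding ideal_divides_def by blast

lemma ideal_prod_list_subset_member:
  assumes "\<forall>P \<in> set Ps. ideal P R" "P \<in> set Ps"
  shows "ideal_prod_list R Ps \<subseteq> P"
  using ideal_divides_imp_subset member_divides_ideal_prod_list[OF assms]
    ideal_prod_list_ideal assms by blast

text \<open>
  The empty list is covered: its product is the whole ring, which no prime contains.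
\<close>

lemma prime_contains_prod_list_member:
  assumes P: "primeideal P R" and "\<forall>Q \<in> set Qs. ideal Q R" "ideal_prod_list R Qs \<subseteq> P"
  shows "\<exists>Q \<in> set Qs. Q \<subseteq> P"
  using assms(2,3)
proof (induction Qs)
  case Nil
  then show ?case
    using primeideal.I_notcarr[OF P] primeideal.axioms(1)[OF P]
    by (auto simp: ideal.Icarr)
next
  case (Cons Q Qs)
  then show ?case
    using primeideal_divides_ideal_prod[OF P, of Q "ideal_prod_list R Qs"]
    by (auto simp: ideal_prod_list_ideal)
qed

section \<open>Cancellation of ideals modulo a prime\<close>

text \<open>
  For \<open>I\<close> containing \<open>P\<close>, this says that the image of \<open>I\<close> in \<open>R/P\<close> can be cancelled from products
  of ideals of \<open>R/P\<close>: those ideals correspond to the ideals of \<open>R\<close> containing \<open>P\<close>, and adding \<open>P\<close> to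
  a product in \<open>R\<close> yields the ideal that corresponds to the product in \<open>R/P\<close>. For \<open>P = 0\<close> it is
  ordinary cancellability.
\<close>

definition cancels_mod :: "'a set \<Rightarrow> 'a set \<Rightarrow> bool"
  where "cancels_mod P I \<longleftrightarrow>
    (\<forall>A B. ideal A R \<longrightarrow> ideal B R \<longrightarrow> P \<subseteq> A \<longrightarrow> P \<subseteq> B \<longrightarrow> P <+> I \<cdot> A = P <+> I \<cdot> B \<longrightarrow> A = B)"

lemma cancels_modD:
  assumes "cancels_mod P I" "ideal A R" "ideal B R" "P \<subseteq> A" "P \<subseteq> B"
    "P <+> I \<cdot> A = P <+> I \<cdot> B"
  shows "A = B"
  using assms unfolding cancels_mod_def by blast

lemma cancels_mod_zeroD:
  assumes "cancels_mod {\<zero>} I" "ideal A R" "ideal B R" "I \<cdot> A = I \<cdot> B"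
  shows "A = B"
  using cancels_modD[OF assms(1-3)] assms
  by (simp add: additive_subgroup.zero_closed ideal.axioms(1))

text \<open>
  Multiplication respects congruence of ideals modulo \<open>P\<close>, because \<open>H P \<subseteq> P\<close>. This is what
  allows a product to be reduced modulo \<open>P\<close> factor by factor.
\<close>

lemma ideal_prod_mod:
  assumes P: "ideal P R" and H: "ideal H R" and X: "ideal X R"
  shows "P <+> H \<cdot> (P <+> X) = P <+> H \<cdot> X"
proof
  note PX = add_ideals[OF P X] and HX = ideal_prod_is_ideal[OF H X]
    and HP = ideal_prod_is_ideal[OF H P]
  note HPX = ideal_prod_is_ideal[OF H PX]
  have "H \<cdot> (P <+> X) = H \<cdot> P <+> H \<cdot> X"
    by (rule ideal_prod_distr(1)[OF H P X])
  also have "\<dots> \<subseteq> P <+> H \<cdot> X"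
    using set_add_subset_iff[OF HP HX add_ideals[OF P HX]] subset_set_add[OF P HX]
      ideal_prod_inter[OF H P] by auto
  finally show "P <+> H \<cdot> (P <+> X) \<subseteq> P <+> H \<cdot> X"
    using set_add_subset_iff[OF P HPX add_ideals[OF P HX]] subset_set_add(1)[OF P HX] by simp
  have "H \<cdot> X \<subseteq> H \<cdot> (P <+> X)"
    by (intro ideal_prod_mono subset_set_add[OF P X] order_refl)
  then show "P <+> H \<cdot> X \<subseteq> P <+> H \<cdot> (P <+> X)"
    using set_add_subset_iff[OF P HX add_ideals[OF P HPX]] subset_set_add[OF P HPX] by simp
qed

text \<open>
  If \<open>J = H I\<close>, multiplying a relation \<open>I A = I B\<close> modulo \<open>P\<close> by \<open>H\<close> turns it into \<open>J A = J B\<close>.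
\<close>

lemma cancels_mod_factor:
  assumes P: "ideal P R" and I: "ideal I R" and J: "ideal J R"
    and div: "ideal_divides R I J" and canc: "cancels_mod P J"
  shows "cancels_mod P I"
  unfolding cancels_mod_def
proof (intro allI impI)
  fix A B
  assume AB: "ideal A R" "ideal B R" "P \<subseteq> A" "P \<subseteq> B" and eq: "P <+> I \<cdot> A = P <+> I \<cdot> B"
  obtain H where H: "ideal H R" "J = H \<cdot> I"
    using div unfolding ideal_divides_def by blast
  have "P <+> J \<cdot> X = P <+> H \<cdot> (P <+> I \<cdot> X)" if "ideal X R" for X
    using that H P I by (simp add: ideal_prod_mod ideal_prod_is_ideal ideal_prod_assoc)
  then have "P <+> J \<cdot> A = P <+> J \<cdot> B"
    using eq AB by simp
  then show "A = B"
    using cancels_modD[OF canc] AB by blast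
qed

text \<open>
  In \<open>R/P\<close> the ideal becomes principal with a nonzero generator, and \<open>R/P\<close> is a domain. In
  \<open>R\<close>: if \<open>x \<in> A\<close>, then \<open>a x = p + a b\<close> with \<open>p \<in> P\<close> and \<open>b \<in> B\<close>, so \<open>a (x - b) \<in> P\<close>, and
  primality gives \<open>x - b \<in> P \<subseteq> B\<close>.
\<close>

lemma cancels_mod_principal:
  assumes P: "primeideal P R" and a: "a \<in> carrier R" "a \<notin> P"
  shows "cancels_mod P (P <+> PIdl a)"
proof -
  interpret P: primeideal P R by fact
  have PI: "ideal P R" by (rule P.is_ideal)
  have aI: "ideal (PIdl a) R" using a by (simp add: cgenideal_ideal)
  have eq: "P <+> (P <+> PIdl a) \<cdot> X = P <+> (PIdl a) \<cdot> X" if "ideal X R" for X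
    using ideal_prod_mod[OF PI that aI] that PI aI
    by (metis add_ideals ideal_prod_commute)
  have sub: "A \<subseteq> B"
    if A: "ideal A R" and B: "ideal B R" and PB: "P \<subseteq> B"
      and e: "P <+> (PIdl a) \<cdot> A = P <+> (PIdl a) \<cdot> B" for A B
  proof
    interpret B: ideal B R by fact
    fix x assume x: "x \<in> A"
    then have xc: "x \<in> carrier R" using ideal_subset_carrier[OF A] by blast
    have "a \<otimes> x \<in> (PIdl a) \<cdot> A"
      using x principal_ideal_prod[OF a(1) A] by blast
    then have "a \<otimes> x \<in> P <+> (PIdl a) \<cdot> B"
      using e subset_set_add(2)[OF PI ideal_prod_is_ideal[OF aI A]] by blast
    then obtain p b where p: "p \<in> P" and b: "b \<in> B" and px: "a \<otimes> x = p \<oplus> a \<otimes> b"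
      unfolding set_add_def' principal_ideal_prod[OF a(1) B] by blast
    have bc: "b \<in> carrier R" and pc: "p \<in> carrier R"
      using b p B.Icarr P.Icarr by auto
    have "a \<otimes> (x \<ominus> b) = a \<otimes> x \<ominus> a \<otimes> b"
      using a xc bc by (simp add: minus_eq r_distr r_minus)
    also have "\<dots> = p"
      unfolding px using a bc pc by (simp add: minus_eq a_assoc r_neg)
    finally have "a \<otimes> (x \<ominus> b) \<in> P" using p by simp
    then have "x \<ominus> b \<in> B"
      using P.I_prime[of a "x \<ominus> b"] a xc bc PB by auto
    then have "(x \<ominus> b) \<oplus> b \<in> B" using b by simp
    then show "x \<in> B" using xc bc by (simp add: minus_eq a_assoc l_neg)
  qed
  show ?thesis
    unfolding cancels_mod_def using eq sub by (metis subset_antisym)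
qed

text \<open>
  The usual argument for uniqueness of prime factorizations: a minimal \<open>I\<close> among the primes on the
  left contains some \<open>J\<close> on the right, which contains some \<open>I'\<close> on the left; minimality gives
  \<open>I = J\<close>, and this common factor is cancelled. The factors on the two sides are thus matched
  exactly and not just modulo \<open>P\<close>, so the products agree in \<open>R\<close>. Only this
  consequence is needed, and stating it instead of equality up to permutation keeps multisets out
  of the proof.
\<close>

lemma prime_factorization_unique_mod:
  assumes P: "ideal P R"
    and "\<forall>I \<in> set Is. primeideal I R \<and> P \<subseteq> I \<and> cancels_mod P I"
    and "\<forall>J \<in> set Js. primeideal J R \<and> P \<subseteq> J"
    and "P <+> ideal_prod_list R Is = P <+> ideal_prod_list R Js"
  shows "ideal_prod_list R Is = ideal_prod_list R Js"
  using assms(2-)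
proof (induction "length Is" arbitrary: Is Js)
  case 0
  have Js: "\<forall>J \<in> set Js. ideal J R" using 0 primeideal.axioms(1) by blast
  have "Js = []"
  proof (cases Js)
    case (Cons J Js')
    have "P \<subseteq> J" "ideal J R" "primeideal J R" using 0 Cons primeideal.axioms(1) by auto
    moreover have "ideal_prod_list R Js \<subseteq> J"
      using ideal_prod_list_subset_member[OF Js] Cons by simp
    ultimately have "P <+> ideal_prod_list R Js \<subseteq> J"
      using set_add_subset_iff[OF P ideal_prod_list_ideal[OF Js]] by simp
    moreover have "carrier R \<subseteq> P <+> ideal_prod_list R Js"
      using 0 subset_set_add(2)[OF P oneideal] by simp
    ultimately have "carrier R = J"
      using ideal_subset_carrier[OF \<open>ideal J R\<close>] by blast
    then show ?thesis using \<open>primeideal J R\<close> primeideal.I_notcarr by blast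
  qed
  then show ?case using 0 by simp
next
  case (Suc n)
  have Is: "\<forall>I \<in> set Is. ideal I R" and Js: "\<forall>J \<in> set Js. ideal J R"
    using Suc.prems primeideal.axioms(1) by blast+
  note Isp = ideal_prod_list_ideal[OF Is] and Jsp = ideal_prod_list_ideal[OF Js]
  have "set Is \<noteq> {}" using Suc.hyps by auto
  then obtain I where I: "I \<in> set Is" and min: "\<And>I'. I' \<in> set Is \<Longrightarrow> I' \<subseteq> I \<Longrightarrow> I' = I"
    using finite_has_minimal[of "set Is"] by auto
  have II: "ideal I R" "primeideal I R" "P \<subseteq> I" "cancels_mod P I"
    using I Is Suc.prems by auto
  have "P <+> ideal_prod_list R Is \<subseteq> I"
    using set_add_subset_iff[OF P Isp II(1)] II ideal_prod_list_subset_member[OF Is I] by simp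
  then have "ideal_prod_list R Js \<subseteq> I"
    using Suc.prems(3) set_add_subset_iff[OF P Jsp II(1)] by simp
  then obtain J where J: "J \<in> set Js" "J \<subseteq> I"
    using prime_contains_prod_list_member[OF II(2) Js] by blast
  have JJ: "ideal J R" "primeideal J R" "P \<subseteq> J"
    using J Js Suc.prems by auto
  have "P <+> ideal_prod_list R Js \<subseteq> J"
    using set_add_subset_iff[OF P Jsp JJ(1)] JJ ideal_prod_list_subset_member[OF Js J(1)] by simp
  then have "ideal_prod_list R Is \<subseteq> J"
    using Suc.prems(3) set_add_subset_iff[OF P Isp JJ(1)] by simp
  then obtain I' where "I' \<in> set Is" "I' \<subseteq> J"
    using prime_contains_prod_list_member[OF JJ(2) Is] by blast
  then have "J = I" using min J(2) by blast
  define Is' where "Is' = remove1 I Is"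
  define Js' where "Js' = remove1 I Js"
  have Isr: "ideal_prod_list R Is = I \<cdot> ideal_prod_list R Is'"
    and Jsr: "ideal_prod_list R Js = I \<cdot> ideal_prod_list R Js'"
    unfolding Is'_def Js'_def
    using ideal_prod_list_remove1[OF Is I] ideal_prod_list_remove1[OF Js] J \<open>J = I\<close> by auto
  have sub: "set Is' \<subseteq> set Is" "set Js' \<subseteq> set Js"
    unfolding Is'_def Js'_def by (rule set_remove1_subset)+
  have Isp': "ideal (ideal_prod_list R Is') R" and Jsp': "ideal (ideal_prod_list R Js') R"
    using sub Is Js by (blast intro: ideal_prod_list_ideal)+
  have "P <+> I \<cdot> (P <+> ideal_prod_list R Is') = P <+> I \<cdot> (P <+> ideal_prod_list R Js')"
    using Suc.prems(3) P II(1) Isp' Jsp' by (simp add: Isr Jsr ideal_prod_mod)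
  then have "P <+> ideal_prod_list R Is' = P <+> ideal_prod_list R Js'"
    using cancels_modD[OF II(4) add_ideals[OF P Isp'] add_ideals[OF P Jsp']]
      subset_set_add(1)[OF P Isp'] subset_set_add(1)[OF P Jsp'] by blast
  moreover have "n = length Is'"
    using Suc.hyps I by (simp add: Is'_def length_remove1)
  ultimately have "ideal_prod_list R Is' = ideal_prod_list R Js'"
    using Suc.hyps(1)[of Is' Js'] Suc.prems sub by blast
  then show ?case by (simp add: Isr Jsr)
qed

end

section \<open>Divisors of nonzero principal ideals\<close>

context "domain"
begin

lemma cancels_principal:
  assumes "a \<in> carrier R" "a \<noteq> \<zero>"
  shows "cancels_mod {\<zero>} (PIdl a)"
  using cancels_mod_principal[OF zeroprimeideal, of a] assms
  by (simp add: zero_set_add cgenideal_ideal)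

lemma divides_principal_imp_cancels:
  assumes "a \<in> carrier R" "a \<noteq> \<zero>" "ideal I R" "ideal_divides R I (PIdl a)"
  shows "cancels_mod {\<zero>} I"
  using cancels_mod_factor[OF zeroideal _ _ _ cancels_principal] assms cgenideal_ideal by blast

text \<open>
  With \<open>H I = (a)\<close>, the inverse of \<open>I\<close> is \<open>H / a\<close>, and the cofactor of \<open>I\<close> in \<open>A\<close> is \<open>A H / a\<close>. It is
  an ideal of \<open>R\<close> because \<open>H A \<subseteq> H I = (a)\<close>, and it appears below as the \<open>B\<close> with \<open>H A = (a) B\<close>.
\<close>

lemma divides_principal_imp_contains_is_divides:
  assumes a: "a \<in> carrier R" "a \<noteq> \<zero>" and I: "ideal I R"
    and div: "ideal_divides R I (PIdl a)" and A: "ideal A R" and sub: "A \<subseteq> I"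
  shows "ideal_divides R I A"
proof -
  note aI = cgenideal_ideal[OF a(1)]
  obtain H where H: "ideal H R" "PIdl a = H \<cdot> I"
    using div unfolding ideal_divides_def by blast
  obtain B where B: "ideal B R" "H \<cdot> A = (PIdl a) \<cdot> B"
    using subset_principal_imp_divides[OF a(1) ideal_prod_is_ideal[OF H(1) A]]
      ideal_prod_mono[OF order_refl sub] H(2) by metis
  have "(PIdl a) \<cdot> A = I \<cdot> (H \<cdot> A)"
    using H A I by (metis ideal_prod_assoc ideal_prod_commute)
  also have "\<dots> = (PIdl a) \<cdot> (B \<cdot> I)"
    using B I aI by (metis ideal_prod_commute ideal_prod_left_commute)
  finally have "A = B \<cdot> I"
    using cancels_mod_zeroD[OF cancels_principal[OF a]] A B I ideal_prod_is_ideal by blast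
  then show ?thesis using B unfolding ideal_divides_def by blast
qed

text \<open>
  With \<open>H I = (a)\<close>, the element \<open>a\<close> is a finite sum of products of elements of \<open>H\<close> and \<open>I\<close>. If \<open>S\<close>
  consists of the finitely many elements of \<open>I\<close> that occur, then \<open>(a) \<subseteq> H (S) \<subseteq> H I = (a)\<close>, and
  cancelling \<open>H\<close> gives \<open>I = (S)\<close>.
\<close>

lemma divides_principal_imp_finitely_generated:
  assumes a: "a \<in> carrier R" "a \<noteq> \<zero>" and I: "ideal I R"
    and div: "ideal_divides R I (PIdl a)"
  shows "\<exists>S \<subseteq> carrier R. finite S \<and> I = Idl S"
proof -
  obtain H where H: "ideal H R" "PIdl a = H \<cdot> I"
    using div unfolding ideal_divides_def by blast
  have Ic: "I \<subseteq> carrier R" using ideal_subset_carrier[OF I] .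
  have "a \<in> H \<cdot> I" using cgenideal_self[OF a(1)] H by simp
  then have "\<exists>S. finite S \<and> S \<subseteq> I \<and> a \<in> H \<cdot> (Idl S)"
  proof (induct rule: ideal_prod.induct)
    case (prod h i)
    then have "finite {i}" "{i} \<subseteq> I" "h \<otimes> i \<in> H \<cdot> (Idl {i})"
      using Ic genideal_self' by (auto intro: ideal_prod.prod)
    then show ?case by blast
  next
    case (sum s t)
    then obtain S T where S: "finite S" "S \<subseteq> I" "s \<in> H \<cdot> (Idl S)"
      and T: "finite T" "T \<subseteq> I" "t \<in> H \<cdot> (Idl T)" by blast
    have c: "S \<union> T \<subseteq> carrier R" using S T Ic by blast
    have "Idl S \<subseteq> Idl (S \<union> T)" "Idl T \<subseteq> Idl (S \<union> T)"
      using subset_Idl_subset[OF c] by simp_all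
    then have "s \<in> H \<cdot> (Idl (S \<union> T))" "t \<in> H \<cdot> (Idl (S \<union> T))"
      using S T ideal_prod_mono[OF order_refl] by blast+
    then show ?case
      using S T by (intro exI[of _ "S \<union> T"]) (auto intro: ideal_prod.sum)
  qed
  then obtain S where S: "finite S" "S \<subseteq> I" "a \<in> H \<cdot> (Idl S)" by blast
  have Sc: "S \<subseteq> carrier R" using S Ic by blast
  note SI = genideal_ideal[OF Sc]
  have "Idl S \<subseteq> I" using genideal_minimal[OF I S(2)] .
  then have "H \<cdot> (Idl S) \<subseteq> H \<cdot> I" by (intro ideal_prod_mono) auto
  moreover have "H \<cdot> I \<subseteq> H \<cdot> (Idl S)"
    using cgenideal_minimal[OF ideal_prod_is_ideal[OF H(1) SI] S(3)] H(2) by simp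
  ultimately have "H \<cdot> I = H \<cdot> (Idl S)" by blast
  moreover have "cancels_mod {\<zero>} H"
    using divides_principal_imp_cancels[OF a H(1)] H I ideal_prod_commute
    unfolding ideal_divides_def by metis
  ultimately have "I = Idl S"
    using cancels_mod_zeroD I SI by blast
  then show ?thesis using S Sc by blast
qed

lemma nonzero_ideal_contains_principal:
  assumes "ideal I R" "I \<noteq> {\<zero>}"
  obtains a where "a \<in> carrier R" "a \<noteq> \<zero>" "a \<in> I" "PIdl a \<subseteq> I"
proof -
  have "\<zero> \<in> I" using assms by (simp add: additive_subgroup.zero_closed ideal.axioms(1))
  then obtain a where "a \<in> I" "a \<noteq> \<zero>" using assms by blast
  then show ?thesis using that[of a] cgenideal_minimal ideal_subset_carrier assms(1) by blast
qed

end

section \<open>Containment-division domains\<close>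

lemma containment_division_nonzero_divides_principal:
  fixes R (structure)
  assumes "domain R" "containment_division_ring R" "ideal I R" "I \<noteq> {\<zero>}"
  obtains a where "a \<in> carrier R" "a \<noteq> \<zero>" "ideal_divides R I (PIdl a)"
proof -
  interpret "domain" R by fact
  interpret containment_division_ring R by fact
  obtain a where "a \<in> carrier R" "a \<noteq> \<zero>" "PIdl a \<subseteq> I"
    using nonzero_ideal_contains_principal assms by blast
  then show ?thesis
    using that subset_iff_divides cgenideal_ideal assms(3) by blast
qed

lemma containment_division_domain_noetherian:
  fixes R (structure)
  assumes "domain R" "containment_division_ring R"
  shows "noetherian_ring R"
proof -
  interpret "domain" R by fact
  show ?thesis
  proof (rule noetherian_ringI)
    fix I assume I: "ideal I R"
    show "\<exists>A \<subseteq> carrier R. finite A \<and> I = Idl A"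
    proof (cases "I = {\<zero>}")
      case True
      then show ?thesis using genideal_zero by (intro exI[of _ "{\<zero>}"]) auto
    next
      case False
      then show ?thesis
        using containment_division_nonzero_divides_principal[OF assms I]
          divides_principal_imp_finitely_generated I by metis
    qed
  qed
qed

lemma noetherian_imp_divisor_chain_condition:
  fixes R (structure)
  assumes "cring R" "noetherian_ring R"
  shows "divisor_chain_condition_ring R"
proof -
  interpret cring R by fact
  interpret noetherian_ring R by fact
  show ?thesis
  proof unfold_locales
    fix I :: "nat \<Rightarrow> 'a set"
    assume I: "\<And>n. ideal (I n) R" and inc: "\<And>n. I n \<subseteq> I (Suc n)"
    have mono: "I i \<subseteq> I j" if "i \<le> j" for i j
      using lift_Suc_mono_le[of I, OF inc that] .
    have "subset.chain {I. ideal I R} (range I)"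
      unfolding subset_chain_def using I mono nat_le_linear by blast
    then obtain m where "\<Union>(range I) = I m"
      using ideal_chain_is_trivial[of "range I"] by blast
    then show "\<exists>m. \<forall>i\<ge>m. I i = I m"
      using mono by blast
  qed
qed

text \<open>
  Noetherian induction: a maximal counterexample \<open>I\<close> is not prime, so \<open>A B \<subseteq> I\<close> for ideals
  \<open>A\<close> and \<open>B\<close> not contained in \<open>I\<close>. The ideal \<open>J = I + A\<close> is then strictly larger than \<open>I\<close> and still
  proper, since otherwise \<open>B = (I + A) B \<subseteq> I\<close>. Division yields \<open>I = H J\<close>.
\<close>

lemma noetherian_containment_division_imp_dedekind:
  fixes R (structure)
  assumes dom: "domain R" and noeth: "noetherian_ring R" and cdr: "containment_division_ring R"
  shows "dedekind_domain R"
proof -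
  interpret "domain" R by fact
  interpret noetherian_ring R by fact
  interpret containment_division_ring R by fact
  define fact where "fact I \<longleftrightarrow>
    (\<exists>Ps. (\<forall>P \<in> set Ps. primeideal P R) \<and> I = ideal_prod_list R Ps)" for I
  define Bad where "Bad = {I. ideal I R \<and> I \<noteq> carrier R \<and> \<not> fact I}"
  have "Bad = {}"
  proof (rule ccontr)
    assume "Bad \<noteq> {}"
    moreover have "\<Union>C \<in> Bad" if "C \<noteq> {}" "subset.chain Bad C" for C
    proof -
      have "subset.chain {I. ideal I R} C"
        using that unfolding subset_chain_def Bad_def by blast
      then show ?thesis
        using ideal_chain_is_trivial[OF that(1)] that unfolding subset_chain_def by blast
    qed
    ultimately obtain I where IB: "I \<in> Bad" and max: "\<And>X. X \<in> Bad \<Longrightarrow> I \<subseteq> X \<Longrightarrow> X = I"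
      using subset_Zorn_nonempty[of Bad] by blast
    have I: "ideal I R" "I \<noteq> carrier R" "\<not> fact I" using IB by (auto simp: Bad_def)
    have larger: "fact X" if "ideal X R" "X \<noteq> carrier R" "I \<subseteq> X" "X \<noteq> I" for X
      using max that unfolding Bad_def by blast
    have "fact P" if "primeideal P R" for P
      unfolding fact_def
      using that by (intro exI[of _ "[P]"]) (simp add: ideal_prod_one primeideal.axioms(1))
    then have np: "\<not> primeideal I R" and nz: "I \<noteq> {\<zero>}"
      using I zeroprimeideal by auto
    obtain A B where AB: "ideal A R" "ideal B R" "A \<cdot> B \<subseteq> I" "\<not> A \<subseteq> I" "\<not> B \<subseteq> I"
      using divides_ideal_prod_imp_primeideal[OF I(1,2)] np by blast
    define J where "J = I <+> A"
    have J: "ideal J R" "I \<subseteq> J" "A \<subseteq> J"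
      unfolding J_def using add_ideals subset_set_add I AB by auto
    have "J \<noteq> I" using J AB by blast
    have "J \<noteq> carrier R"
    proof
      assume "J = carrier R"
      then have "B = (I <+> A) \<cdot> B" using one_ideal_prod[OF AB(2)] J_def by simp
      also have "\<dots> = I \<cdot> B <+> A \<cdot> B" using ideal_prod_distr(2) I AB by blast
      also have "\<dots> \<subseteq> I"
        using set_add_subset_iff[of "I \<cdot> B" "A \<cdot> B" I] ideal_prod_inter[OF I(1) AB(2)]
          I AB ideal_prod_is_ideal by blast
      finally show False using AB by blast
    qed
    obtain H where H: "ideal H R" "I = H \<cdot> J"
      using subset_iff_divides[OF I(1) J(1)] J(2) unfolding ideal_divides_def by blast
    have IH: "I \<subseteq> H" using ideal_prod_inter[OF H(1) J(1)] H by blast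
    have "H \<noteq> carrier R" using H \<open>J \<noteq> I\<close> one_ideal_prod J by metis
    \<comment> \<open>Otherwise \<open>I = I J\<close>, and cancelling \<open>I\<close> would make \<open>J\<close> the whole ring.\<close>
    moreover have "H \<noteq> I"
    proof
      assume "H = I"
      then have "I \<cdot> J = I \<cdot> carrier R" using H I by (simp add: ideal_prod_one)
      moreover obtain a where "a \<in> carrier R" "a \<noteq> \<zero>" "ideal_divides R I (PIdl a)"
        using containment_division_nonzero_divides_principal[OF dom cdr I(1) nz] .
      ultimately show False
        using cancels_mod_zeroD[OF divides_principal_imp_cancels] I J oneideal \<open>J \<noteq> carrier R\<close>
        by blast
    qed
    ultimately have "fact H" "fact J"
      using larger H J IH \<open>J \<noteq> I\<close> \<open>J \<noteq> carrier R\<close> by auto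
    then obtain Ps Qs where PQ: "\<forall>P \<in> set Ps. primeideal P R" "H = ideal_prod_list R Ps"
      "\<forall>P \<in> set Qs. primeideal P R" "J = ideal_prod_list R Qs"
      unfolding fact_def by blast
    then have "I = ideal_prod_list R (Ps @ Qs)"
      using ideal_prod_list_append[of Ps Qs] H primeideal.axioms(1) by metis
    then have "fact I"
      unfolding fact_def using PQ by (intro exI[of _ "Ps @ Qs"]) auto
    then show False using I by blast
  qed
  then show ?thesis
    unfolding Bad_def fact_def by unfold_locales blast
qed

section \<open>Dedekind domains\<close>

context dedekind_domain
begin

lemma ideal_prime_factorization:
  assumes "ideal I R"
  obtains Ps where "\<forall>P \<in> set Ps. primeideal P R" "I = ideal_prod_list R Ps"
proof (cases "I = carrier R")
  case True
  then show ?thesis using that[of "[]"] by simp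
next
  case False
  then show ?thesis using that proper_ideal_prime_product assms by blast
qed

text \<open>
  An invertible prime is maximal. Put \<open>K = P + (a)\<close> and \<open>L = P + (a\<^sup>2)\<close>. Then \<open>K\<^sup>2\<close> and \<open>L\<close> agree modulo
  \<open>P\<close>, and the prime factors of \<open>K\<close> cancel modulo \<open>P\<close> because \<open>K\<close> does, so uniqueness of
  factorization gives \<open>K\<^sup>2 = L\<close>. Therefore \<open>P \<subseteq> K\<^sup>2 = P K + a K\<close>. For \<open>p = u + a y\<close> in this
  decomposition, \<open>a y = p - u \<in> P\<close> and hence \<open>y \<in> P\<close>, so \<open>a y \<in> P K\<close>. Thus \<open>P = P K\<close>, and \<open>P\<close>
  can be cancelled.
\<close>

lemma cancellable_prime_sum_principal:
  assumes P: "primeideal P R" and canc: "cancels_mod {\<zero>} P"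
    and a: "a \<in> carrier R" "a \<notin> P"
  shows "P <+> PIdl a = carrier R"
proof -
  interpret P: primeideal P R by fact
  note PI = P.is_ideal and aI = cgenideal_ideal[OF a(1)]
  define K where "K = P <+> PIdl a"
  define L where "L = P <+> PIdl (a \<otimes> a)"
  have aaI: "ideal (PIdl (a \<otimes> a)) R" using a by (simp add: cgenideal_ideal)
  have K: "ideal K R" "P \<subseteq> K" and L: "ideal L R" "P \<subseteq> L"
    unfolding K_def L_def using PI aI aaI by (simp_all add: add_ideals subset_set_add)
  have cK: "cancels_mod P K"
    unfolding K_def by (rule cancels_mod_principal[OF P a])
  have "P <+> K \<cdot> K = P <+> K \<cdot> (PIdl a)"
    using ideal_prod_mod[OF PI K(1) aI] K_def by simp
  also have "\<dots> = P <+> (PIdl a) \<cdot> (P <+> PIdl a)"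
    using ideal_prod_commute[OF K(1) aI] K_def by simp
  also have "\<dots> = L"
    using ideal_prod_mod[OF PI aI aI] a by (simp add: principal_ideal_prod_principal L_def)
  also have "L = P <+> L"
    using set_add_subset_iff[OF PI L(1) L(1)] subset_set_add[OF PI L(1)] L(2) by blast
  finally have KL: "P <+> K \<cdot> K = P <+> L" .
  obtain Is where Is: "\<forall>I \<in> set Is. primeideal I R" "K = ideal_prod_list R Is"
    using ideal_prime_factorization[OF K(1)] .
  obtain Js where Js: "\<forall>J \<in> set Js. primeideal J R" "L = ideal_prod_list R Js"
    using ideal_prime_factorization[OF L(1)] .
  have IsI: "\<forall>I \<in> set Is. ideal I R" and JsI: "\<forall>J \<in> set Js. ideal J R"
    using Is Js primeideal.axioms(1) by blast+
  have KK: "ideal_prod_list R (Is @ Is) = K \<cdot> K"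
    using ideal_prod_list_append[OF IsI IsI] Is by simp
  \<comment> \<open>Listing the factors of \<open>K\<close> twice gives a prime factorization of \<open>K\<^sup>2\<close>.\<close>
  have "\<forall>I \<in> set (Is @ Is). primeideal I R \<and> P \<subseteq> I \<and> cancels_mod P I"
    using Is K ideal_prod_list_subset_member[OF IsI] member_divides_ideal_prod_list[OF IsI]
      cancels_mod_factor[OF PI _ K(1) _ cK] IsI by auto
  moreover have "\<forall>J \<in> set Js. primeideal J R \<and> P \<subseteq> J"
    using Js L ideal_prod_list_subset_member[OF JsI] by blast
  ultimately have "ideal_prod_list R (Is @ Is) = ideal_prod_list R Js"
    using KL KK Js(2) by (intro prime_factorization_unique_mod[OF PI]) auto
  then have "K \<cdot> K = L" using KK Js by simp
  have "P \<subseteq> P \<cdot> K"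
  proof
    interpret K: ideal K R by (rule K(1))
    fix p assume p: "p \<in> P"
    then have "p \<in> K \<cdot> (P <+> PIdl a)" using L \<open>K \<cdot> K = L\<close> K_def by auto
    also have "\<dots> = P \<cdot> K <+> (PIdl a) \<cdot> K"
      using ideal_prod_distr(1)[OF K(1) PI aI] ideal_prod_commute K PI aI by simp
    finally obtain u y where u: "u \<in> P \<cdot> K" and y: "y \<in> K" and puy: "p = u \<oplus> a \<otimes> y"
      unfolding set_add_def' principal_ideal_prod[OF a(1) K(1)] by blast
    have uP: "u \<in> P" using u ideal_prod_inter[OF PI K(1)] by blast
    have c: "u \<in> carrier R" "y \<in> carrier R" "p \<in> carrier R"
      using uP y p P.Icarr K.Icarr by auto
    have "a \<otimes> y = p \<ominus> u"
      unfolding puy using a c by (simp add: minus_eq a_ac r_neg2 r_neg1 r_neg)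
    then have "a \<otimes> y \<in> P"
      using p uP by (simp add: minus_eq)
    then have "y \<in> P" using P.I_prime a c by blast
    moreover have "a \<in> K"
      using subset_set_add(2)[OF PI aI] cgenideal_self[OF a(1)] K_def by blast
    ultimately have "y \<otimes> a \<in> P \<cdot> K" by (rule ideal_prod.prod)
    then show "p \<in> P \<cdot> K"
      unfolding puy using u a c by (simp add: m_comm ideal_prod.sum)
  qed
  then have "P \<cdot> K = P \<cdot> carrier R"
    using ideal_prod_inter[OF PI K(1)] ideal_prod_one[OF PI] by blast
  then show ?thesis
    using cancels_mod_zeroD[OF canc K(1) oneideal] K_def by simp
qed

text \<open>
  Some prime factor \<open>Q\<close> of \<open>(a)\<close> lies in \<open>P\<close>. As a factor of \<open>(a)\<close> it is cancellable, hence maximal,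
  so \<open>P = Q\<close>.
\<close>

lemma nonzero_prime_divides_principal:
  assumes P: "primeideal P R" and a: "a \<in> carrier R" "a \<noteq> \<zero>" "a \<in> P"
  shows "ideal_divides R P (PIdl a)"
proof -
  note PI = primeideal.axioms(1)[OF P] and aI = cgenideal_ideal[OF a(1)]
  obtain Qs where Qs: "\<forall>Q \<in> set Qs. primeideal Q R" "PIdl a = ideal_prod_list R Qs"
    using ideal_prime_factorization[OF aI] .
  have QsI: "\<forall>Q \<in> set Qs. ideal Q R"
    using Qs primeideal.axioms(1) by blast
  obtain Q where Q: "Q \<in> set Qs" "Q \<subseteq> P"
    using prime_contains_prod_list_member[OF P QsI] Qs cgenideal_minimal[OF PI a(3)] by auto
  have div: "ideal_divides R Q (PIdl a)"
    using member_divides_ideal_prod_list[OF QsI Q(1)] Qs by simp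
  have QI: "ideal Q R" using Q QsI by blast
  have "P \<subseteq> Q"
  proof (rule ccontr)
    assume "\<not> P \<subseteq> Q"
    then obtain b where b: "b \<in> P" "b \<notin> Q" by blast
    then have "b \<in> carrier R" using ideal_subset_carrier[OF PI] by blast
    then have "Q <+> PIdl b = carrier R"
      using cancellable_prime_sum_principal[OF _ divides_principal_imp_cancels[OF a(1,2) QI div]]
        Q Qs b by blast
    moreover have "Q <+> PIdl b \<subseteq> P"
      using set_add_subset_iff[OF QI cgenideal_ideal PI] cgenideal_minimal[OF PI b(1)]
        \<open>b \<in> carrier R\<close> Q by blast
    ultimately have "carrier R = P" using ideal_subset_carrier[OF PI] by blast
    then show False using primeideal.I_notcarr[OF P] by blast
  qed
  then show ?thesis using div Q by simp
qed

text \<open>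
  Products of invertible ideals are invertible, so the prime case carries over to all
  ideals along their factorizations.
\<close>

lemma nonzero_ideal_divides_principal:
  assumes I: "ideal I R" "I \<noteq> {\<zero>}"
  shows "\<exists>a \<in> carrier R. a \<noteq> \<zero> \<and> ideal_divides R I (PIdl a)"
proof -
  have "\<exists>a \<in> carrier R. a \<noteq> \<zero> \<and> ideal_divides R (ideal_prod_list R Ps) (PIdl a)"
    if "\<forall>P \<in> set Ps. primeideal P R" "ideal_prod_list R Ps \<noteq> {\<zero>}" for Ps
    using that
  proof (induction Ps)
    case Nil
    have "ideal_divides R (carrier R) (PIdl \<one>)"
      unfolding ideal_divides_def using cgenideal_ideal[of \<one>] by (metis ideal_prod_one one_closed)
    then show ?case by (intro bexI[of _ \<one>]) auto
  next
    case (Cons P Ps)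
    let ?X = "ideal_prod_list R Ps"
    have P: "primeideal P R" "ideal P R" using Cons.prems primeideal.axioms(1) by auto
    have X: "ideal ?X R"
      using Cons.prems primeideal.axioms(1) by (intro ideal_prod_list_ideal) auto
    have nz: "P \<noteq> {\<zero>}" "?X \<noteq> {\<zero>}"
      using Cons.prems P X ideal_prod_zero ideal_prod_commute zeroideal by (metis ideal_prod_list_Cons)+
    obtain a where a: "a \<in> carrier R" "a \<noteq> \<zero>" "ideal_divides R P (PIdl a)"
      using nonzero_ideal_contains_principal[OF P(2) nz(1)] nonzero_prime_divides_principal[OF P(1)]
      by metis
    obtain b where b: "b \<in> carrier R" "b \<noteq> \<zero>" "ideal_divides R ?X (PIdl b)"
      using Cons nz by auto
    obtain G H where GH: "ideal G R" "ideal H R" "PIdl a = G \<cdot> P" "PIdl b = H \<cdot> ?X"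
      using a b unfolding ideal_divides_def by blast
    have "PIdl (a \<otimes> b) = (G \<cdot> P) \<cdot> (H \<cdot> ?X)"
      using principal_ideal_prod_principal[OF a(1) b(1)] GH by simp
    also have "\<dots> = (G \<cdot> H) \<cdot> (P \<cdot> ?X)"
      using GH P X by (simp add: ideal_prod_assoc ideal_prod_is_ideal ideal_prod_left_commute)
    finally have "ideal_divides R (ideal_prod_list R (P # Ps)) (PIdl (a \<otimes> b))"
      unfolding ideal_divides_def using ideal_prod_is_ideal[OF GH(1,2)] by auto
    then show ?case
      using a b integral by (intro bexI[of _ "a \<otimes> b"]) auto
  qed
  then show ?thesis using ideal_prime_factorization[OF I(1)] I(2) by metis
qed

lemma containment_division: "containment_division_ring R"
proof unfold_locales
  fix I J assume I: "ideal I R" and J: "ideal J R"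
  show "I \<subseteq> J \<longleftrightarrow> ideal_divides R J I"
  proof
    assume "ideal_divides R J I"
    then show "I \<subseteq> J" using ideal_divides_imp_subset I J by blast
  next
    assume sub: "I \<subseteq> J"
    show "ideal_divides R J I"
    proof (cases "J = {\<zero>}")
      case True
      then have "I = {\<zero>}"
        using sub I additive_subgroup.zero_closed ideal.axioms(1) by blast
      then show ?thesis
        unfolding ideal_divides_def using True ideal_prod_zero[OF zeroideal] zeroideal by metis
    next
      case False
      then show ?thesis
        using nonzero_ideal_divides_principal[OF J] divides_principal_imp_contains_is_divides J I sub
        by blast
    qed
  qed
qed

end

theorem theorem1p2:
  fixes R :: "('a, 'b) ring_scheme" (structure)
  assumes "domain R"
  shows "(dedekind_domain R \<longleftrightarrow> noetherian_ring R \<and> containment_division_ring R) \<and>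
         (noetherian_ring R \<and> containment_division_ring R \<longleftrightarrow>
            containment_division_ring R \<and> divisor_chain_condition_ring R)"
  using dedekind_domain.containment_division containment_division_domain_noetherian[OF assms]
    noetherian_containment_division_imp_dedekind[OF assms]
    noetherian_imp_divisor_chain_condition[OF domain.axioms(1)[OF assms]]
  by blast

end
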